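(* Let $\beta,\lambda$ be real numbers with $\beta\ge\lambda>0$ (so that $0\le 1-\frac{\lambda^2}{\beta^2}<1$), and let $s\in\mathbb{C}$. Then $$\int_{-\pi}^{\pi}\left(\frac{\cos^2\theta}{\beta^2}+\frac{\sin^2\theta}{\lambda^2}\right)^{s}d\theta=\frac{2\pi\lambda}{\beta^{1+2s}}\;{}_2F_1\left(\tfrac12,\,1+s;\,1;\,1-\frac{\lambda^2}{\beta^2}\right).$$
   Context: Powers of positive real numbers are $x^{s}=e^{s\ln x}$. The Gauss hypergeometric function is ${}_2F_1(a,b;c;z)=\sum_{n=0}^{\infty}\frac{(a)_n(b)_n}{(c)_n\,n!}z^n$ for $|z|<1$, where $(a)_0=1$ and $(a)_n=a(a+1)\cdots(a+n-1)$ for $n\ge1$. *)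

theory Defs
  imports "HOL-Analysis.Analysis"
begin

text \<open>
  Only meaningful for \<open>norm z < 1\<close> and \<open>c\<close> not a nonpositive integer; elsewhere
  \<open>suminf\<close> and division by zero may return junk values.
\<close>
definition hypergeo_2F1 :: "complex \<Rightarrow> complex \<Rightarrow> complex \<Rightarrow> complex \<Rightarrow> complex" where
  "hypergeo_2F1 a b c z =
     (\<Sum>n. (pochhammer a n * pochhammer b n) / (pochhammer c n * fact n) * z ^ n)"

lemma hypergeo_2F1_eq_eval_fps:
  "hypergeo_2F1 a b c z = eval_fps (fps_hypergeo [a, b] [c] 1) z"
  by (simp add: hypergeo_2F1_def eval_fps_def fps_hypergeo_def)

lemma summable_hypergeo_2F1:
  fixes a b c z :: complex
  assumes z: "norm z < 1" and c: "c \<notin> \<int>\<^sub>\<le>\<^sub>0"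
  shows "summable (\<lambda>n. (pochhammer a n * pochhammer b n) / (pochhammer c n * fact n) * z ^ n)"
    (is "summable ?f")
proof -
  have lim1: "(\<lambda>n. (x + of_nat n) / of_nat (Suc n)) \<longlonglongrightarrow> 1" for x :: complex
  proof -
    have "(\<lambda>n. 1 + (x - 1) * inverse (of_nat (Suc n))) \<longlonglongrightarrow> 1 + (x - 1) * 0"
      by (intro tendsto_intros LIMSEQ_Suc[OF lim_inverse_n])
    moreover have "1 + (x - 1) * inverse (of_nat (Suc n)) = (x + of_nat n) / of_nat (Suc n)" for n
      by (simp add: divide_simps del: of_nat_Suc) simp
    ultimately show ?thesis by simp
  qed
  define q where "q n = ((a + of_nat n) / of_nat (Suc n)) * ((b + of_nat n) / of_nat (Suc n))
      / ((c + of_nat n) / of_nat (Suc n)) * z" for n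
  have "q \<longlonglongrightarrow> 1 * 1 / 1 * z"
    unfolding q_def by (intro tendsto_intros lim1) auto
  hence "(\<lambda>n. norm (q n)) \<longlonglongrightarrow> norm z"
    using tendsto_norm by fastforce
  moreover obtain r where r: "norm z < r" "r < 1"
    using dense z by blast
  ultimately have "\<forall>\<^sub>F n in sequentially. norm (q n) < r"
    by (simp add: order_tendstoD(2))
  then obtain N where N: "\<And>n. n \<ge> N \<Longrightarrow> norm (q n) < r"
    by (auto simp: eventually_at_top_linorder)
  have step: "?f (Suc n) = q n * ?f n" for n
  proof -
    have cancel: "(A / m) * (B / m) / (C / m) = A * B / (C * m)" if "m \<noteq> 0" for A B C m :: complex
      using that by (simp add: divide_simps)
    have "q n = (a + of_nat n) * (b + of_nat n) / ((c + of_nat n) * of_nat (Suc n)) * z"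
      unfolding q_def by (subst cancel) (simp_all del: of_nat_Suc)
    thus ?thesis
      by (simp add: pochhammer_Suc mult_ac del: of_nat_Suc)
  qed
  show ?thesis
  proof (rule summable_ratio_test[OF r(2)])
    fix n assume "n \<ge> N"
    from N[OF this] show "norm (?f (Suc n)) \<le> r * norm (?f n)"
      unfolding step norm_mult[of "q n"] by (intro mult_right_mono) auto
  qed
qed

end

(*
  Put tan \<theta> = (lam / \<beta>) tan \<phi>. The integrand becomes \<beta> powr (-2s) * (1 - k sin^2 \<phi>) powr (-s) with
  k = 1 - lam^2 / \<beta>^2, and d\<theta> = (lam / \<beta>) d\<phi> / (1 - k sin^2 \<phi>), so it remains to integrate
  (1 - k sin^2 \<phi>) powr (-1-s). Expanding in the binomial series, which converges uniformly because
  k < 1, and inserting the Wallis integrals of sin^(2n) gives the hypergeometric series.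
*)
theory Submission
  imports Defs
begin

section \<open>Wallis integrals and termwise integration of the binomial series\<close>

text \<open>Integrating the derivative of \<open>- cos x * sin x ^ (2 * n + 1)\<close>, which
  vanishes at both endpoints, gives (2n+2) W(n+1) = (2n+1) W(n) for the Wallis integrals W. The
  factor (n + 1/2) / (n + 1) is exactly the step from n to n+1 of
  \<open>pochhammer (1 / 2) n / fact n\<close>.\<close>

lemma has_integral_sin_power_even:
  "((\<lambda>x. sin x ^ (2 * n)) has_integral 2 * pi * pochhammer (1 / 2) n / fact n) {-pi..pi}"
proof (induction n)
  case 0
  show ?case using has_integral_const_real[of "1::real" "-pi" pi] by simp
next
  case (Suc n)
  let ?F = "\<lambda>x::real. - (cos x * sin x ^ (2 * n + 1))"
  have "((\<lambda>x. (2 * real n + 2) * sin x ^ (2 * n + 2) - (2 * real n + 1) * sin x ^ (2 * n))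
      has_integral ?F pi - ?F (- pi)) {-pi..pi}"
  proof (intro fundamental_theorem_of_calculus)
    fix x :: real
    have "(?F has_real_derivative
        sin x * sin x ^ (2 * n + 1) - (2 * real n + 1) * sin x ^ (2 * n) * (cos x)\<^sup>2) (at x within {-pi..pi})"
      by (rule derivative_eq_intros refl)+ (simp add: power2_eq_square algebra_simps)
    also have "sin x * sin x ^ (2 * n + 1) - (2 * real n + 1) * sin x ^ (2 * n) * (cos x)\<^sup>2 =
        (2 * real n + 2) * sin x ^ (2 * n + 2) - (2 * real n + 1) * sin x ^ (2 * n)"
      unfolding cos_squared_eq by (simp add: power2_eq_square algebra_simps)
    finally show "(?F has_vector_derivative
        (2 * real n + 2) * sin x ^ (2 * n + 2) - (2 * real n + 1) * sin x ^ (2 * n))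
        (at x within {-pi..pi})"
      by (simp add: has_real_derivative_iff_has_vector_derivative)
  qed simp
  from has_integral_add[OF this has_integral_mult_right[OF Suc.IH, of "2 * real n + 1"]]
  have "((\<lambda>x. (2 * real n + 2) * sin x ^ (2 * n + 2)) has_integral
      (2 * real n + 1) * (2 * pi * pochhammer (1 / 2) n / fact n)) {-pi..pi}"
    by simp
  note * = has_integral_mult_right[OF this, of "1 / (2 * real n + 2)"]
  have **: "((\<lambda>x. sin x ^ (2 * Suc n)) has_integral
      1 / (2 * real n + 2) * ((2 * real n + 1) * (2 * pi * pochhammer (1 / 2) n / fact n))) {-pi..pi}"
  proof -
    have "2 * real n + 2 \<noteq> 0" by linarith
    then have "1 / (2 * real n + 2) * ((2 * real n + 2) * y) = y" for y
      by simp
    with * show ?thesis by (simp only: mult_Suc_right add.commute)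
  qed
  have "1 / (2 * real n + 2) * ((2 * real n + 1) * (2 * pi * pochhammer (1 / 2) n / fact n)) =
      2 * pi * pochhammer (1 / 2) (Suc n) / fact (Suc n)"
    by (simp add: pochhammer_Suc divide_simps) (simp add: algebra_simps)
  with ** show ?case by simp
qed

text \<open>The binomial coefficient of \<open>- a\<close> carries a sign \<open>(- 1) ^ n\<close>,
  which cancels against that of \<open>(- z) ^ n\<close> in the binomial series at
  \<open>- z\<close>.\<close>

lemma powr_minus_sums_pochhammer:
  fixes a z :: complex
  assumes "norm z < 1"
  shows "(\<lambda>n. pochhammer a n / fact n * z ^ n) sums (1 - z) powr (- a)"
proof -
  have "(- a gchoose n) * (- z) ^ n = pochhammer a n / fact n * z ^ n" for n
  proof -
    have "(- 1) ^ n * (- z) ^ n = z ^ n"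
      by (simp flip: power_mult_distrib)
    then show ?thesis
      by (simp add: gbinomial_pochhammer mult_ac)
  qed
  then show ?thesis
    using gen_binomial_complex[of "- z" "- a"] assms by simp
qed

lemma has_integral_hypergeo_2F1_half:
  fixes a z :: complex
  assumes z: "norm z < 1"
  shows "((\<lambda>x. (1 - z * complex_of_real ((sin x)\<^sup>2)) powr (- a)) has_integral
    2 * complex_of_real pi * hypergeo_2F1 (1 / 2) a 1 z) {-pi..pi}"
proof -
  define c where "c n = pochhammer a n / fact n * z ^ n" for n
  define f where "f n x = c n * complex_of_real (sin x ^ (2 * n))" for n x
  let ?g = "\<lambda>x. (1 - z * complex_of_real ((sin x)\<^sup>2)) powr (- a)"
  define h where
    "h n = (pochhammer (1 / 2) n * pochhammer a n) / (pochhammer 1 n * fact n) * z ^ n" for n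
  \<comment> \<open>Convergence of the power series at a point \<open>r\<close> of larger modulus
    than \<open>z\<close> yields absolute convergence at \<open>z\<close>.\<close>
  obtain r :: real where r: "norm z < r" "r < 1"
    using z dense by blast
  then have "\<bar>r\<bar> = r"
    using norm_ge_zero[of z] by linarith
  have "summable (\<lambda>n. pochhammer a n / fact n * complex_of_real r ^ n)"
    using r \<open>\<bar>r\<bar> = r\<close> by (intro sums_summable[OF powr_minus_sums_pochhammer]) simp
  then have summable_c: "summable (\<lambda>n. norm (c n))"
    unfolding c_def by (rule powser_insidea) (use r \<open>\<bar>r\<bar> = r\<close> in simp)
  have f_sums: "(\<lambda>n. f n x) sums ?g x" for x
  proof -
    have "norm (z * complex_of_real ((sin x)\<^sup>2)) \<le> norm z"
      by (simp add: norm_mult norm_power abs_square_le_1 mult_left_le)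
    then have "norm (z * complex_of_real ((sin x)\<^sup>2)) < 1"
      using z by simp
    from powr_minus_sums_pochhammer[OF this, of a] show ?thesis
      by (simp add: f_def c_def power_mult_distrib mult_ac flip: power_mult)
  qed
  \<comment> \<open>Since \<open>sin\<close> is bounded by 1 in modulus, \<open>norm (c n)\<close>
    is a majorant independent of \<open>x\<close>; uniform convergence then allows integral and
    limit to be exchanged.\<close>
  have "uniform_limit {-pi..pi} (\<lambda>n x. \<Sum>i<n. f i x) (\<lambda>x. \<Sum>i. f i x) sequentially"
    by (rule Weierstrass_m_test[OF _ summable_c])
       (simp add: f_def norm_mult norm_power mult_left_le power_le_one)
  also have "(\<lambda>x. \<Sum>i. f i x) = ?g"
    using f_sums by (simp add: sums_iff)
  finally obtain I J where I: "\<And>n. ((\<lambda>x. \<Sum>i<n. f i x) has_integral I n) {-pi..pi}"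
    and J: "(?g has_integral J) {-pi..pi}" and lim: "I \<longlonglongrightarrow> J"
  proof (rule uniform_limit_integral)
    show "continuous_on {- pi..pi} (\<lambda>x. \<Sum>i<n. f i x)" for n
      unfolding f_def by (intro continuous_intros)
  qed auto
  have "(f i has_integral 2 * complex_of_real pi * h i) {-pi..pi}" for i
  proof -
    have "complex_of_real (pochhammer (1 / 2) i) = pochhammer (1 / 2) i"
      "pochhammer (1 :: complex) i = fact i"
      by (simp_all flip: pochhammer_of_real pochhammer_fact)
    then have "c i * complex_of_real (2 * pi * pochhammer (1 / 2) i / fact i) =
        2 * complex_of_real pi * h i"
      by (simp add: c_def h_def)
    moreover have "(f i has_integral c i * complex_of_real (2 * pi * pochhammer (1 / 2) i / fact i))
        {-pi..pi}"
      unfolding f_def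
      by (intro has_integral_mult_right has_integral_of_real has_integral_sin_power_even)
    ultimately show ?thesis by simp
  qed
  then have "((\<lambda>x. \<Sum>i<n. f i x) has_integral (\<Sum>i<n. 2 * complex_of_real pi * h i)) {-pi..pi}" for n
    by (intro has_integral_sum) auto
  then have "I = (\<lambda>n. \<Sum>i<n. 2 * complex_of_real pi * h i)"
    using I has_integral_unique by blast
  with lim have "(\<lambda>i. 2 * complex_of_real pi * h i) sums J"
    by (simp add: sums_def)
  moreover have "h sums hypergeo_2F1 (1 / 2) a 1 z"
  proof -
    have "(1::complex) \<notin> \<int>\<^sub>\<le>\<^sub>0"
      by simp
    from summable_hypergeo_2F1[OF z this] show ?thesis
      unfolding h_def hypergeo_2F1_def by (rule summable_sums)
  qed
  ultimately have "J = 2 * complex_of_real pi * hypergeo_2F1 (1 / 2) a 1 z"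
    using sums_unique2 sums_mult by blast
  with J show ?thesis by simp
qed

section \<open>The change of angle that straightens the ellipse\<close>

text \<open>
  \<open>ellipse_angle a b\<close> is the smooth branch through the origin of
  \<open>tan \<theta> = (b / a) tan \<phi>\<close>, written via the addition theorem for
  \<open>tan (\<theta> - \<phi>)\<close> so that no case distinction at the poles of \<open>tan\<close> occurs.
\<close>

definition ellipse_angle :: "real \<Rightarrow> real \<Rightarrow> real \<Rightarrow> real" where
  "ellipse_angle a b x =
     x + arctan ((b - a) * sin x * cos x / (a * (cos x)\<^sup>2 + b * (sin x)\<^sup>2))"

context
  fixes a b :: real
  assumes a: "a > 0" and b: "b > 0"
begin

text \<open>Kept general in the positive coefficients: it serves for the denominator in
  \<open>ellipse_angle\<close>, and later for squared coefficients and their reciprocals.\<close>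

lemma ellipse_pos: "a * (cos x)\<^sup>2 + b * (sin x)\<^sup>2 > 0"
proof (cases "cos x = 0")
  case True
  then show ?thesis using b sin_cos_squared_add[of x] by simp
next
  case False
  then show ?thesis using a b by (intro add_pos_nonneg) auto
qed

text \<open>Pythagoras: the two squared terms are the components of the vector (a cos x, b sin x)
  along the unit vector (cos x, sin x) and perpendicular to it.\<close>

lemma ellipse_norm:
  "(a * (cos x)\<^sup>2 + b * (sin x)\<^sup>2)\<^sup>2 + ((b - a) * sin x * cos x)\<^sup>2 =
    a\<^sup>2 * (cos x)\<^sup>2 + b\<^sup>2 * (sin x)\<^sup>2"
proof -
  have "(a * (cos x)\<^sup>2 + b * (sin x)\<^sup>2)\<^sup>2 + ((b - a) * sin x * cos x)\<^sup>2 =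
      (a\<^sup>2 * (cos x)\<^sup>2 + b\<^sup>2 * (sin x)\<^sup>2) * ((sin x)\<^sup>2 + (cos x)\<^sup>2)"
    by algebra
  then show ?thesis by simp
qed

text \<open>The vector (a cos x, b sin x) has polar angle \<open>ellipse_angle a b x\<close>:
  relative to the direction \<open>x\<close> its components are \<open>D\<close> and
  \<open>N\<close>, and \<open>D > 0\<close> makes \<open>arctan (N / D)\<close> the correct angle
  between the two. Dividing by the length \<open>R\<close> gives cosine and sine.\<close>

lemma cos_sin_ellipse_angle:
  "cos (ellipse_angle a b x) = a * cos x / sqrt (a\<^sup>2 * (cos x)\<^sup>2 + b\<^sup>2 * (sin x)\<^sup>2)" (is ?cos)
  "sin (ellipse_angle a b x) = b * sin x / sqrt (a\<^sup>2 * (cos x)\<^sup>2 + b\<^sup>2 * (sin x)\<^sup>2)" (is ?sin)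
proof -
  define D where "D = a * (cos x)\<^sup>2 + b * (sin x)\<^sup>2"
  define N where "N = (b - a) * sin x * cos x"
  define R where "R = sqrt (a\<^sup>2 * (cos x)\<^sup>2 + b\<^sup>2 * (sin x)\<^sup>2)"
  have D: "D > 0" unfolding D_def by (rule ellipse_pos)
  have "1 + (N / D)\<^sup>2 = (a\<^sup>2 * (cos x)\<^sup>2 + b\<^sup>2 * (sin x)\<^sup>2) / D\<^sup>2"
    using D ellipse_norm[of x, folded D_def N_def] by (simp add: field_simps)
  then have "sqrt (1 + (N / D)\<^sup>2) = R / D"
    using D by (simp add: R_def real_sqrt_divide)
  then have cs: "cos (arctan (N / D)) = D / R" "sin (arctan (N / D)) = N / R"
    using D by (simp_all add: cos_arctan sin_arctan)
  \<comment> \<open>Rotating (D, N) by the angle \<open>x\<close> recovers the original vector, here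
    its first coordinate.\<close>
  have "cos x * D - sin x * N = a * cos x * ((sin x)\<^sup>2 + (cos x)\<^sup>2)"
    unfolding D_def N_def by algebra
  then show ?cos
    using cs unfolding ellipse_angle_def D_def[symmetric] N_def[symmetric] R_def[symmetric]
    by (simp add: cos_add flip: diff_divide_distrib)
  have "sin x * D + cos x * N = b * sin x * ((sin x)\<^sup>2 + (cos x)\<^sup>2)"
    unfolding D_def N_def by algebra
  then show ?sin
    using cs unfolding ellipse_angle_def D_def[symmetric] N_def[symmetric] R_def[symmetric]
    by (simp add: sin_add flip: add_divide_distrib)
qed

lemma ellipse_angle_deriv:
  "(ellipse_angle a b has_real_derivative a * b / (a\<^sup>2 * (cos x)\<^sup>2 + b\<^sup>2 * (sin x)\<^sup>2)) (at x within S)"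
proof -
  define s c where "s = sin x" and "c = cos x"
  define D where "D = a * c\<^sup>2 + b * s\<^sup>2"
  define N where "N = (b - a) * s * c"
  define N' where "N' = (b - a) * (c\<^sup>2 - s\<^sup>2)"
  define D' where "D' = 2 * (b - a) * s * c"
  define Q where "Q = a\<^sup>2 * c\<^sup>2 + b\<^sup>2 * s\<^sup>2"
  have D: "D > 0" unfolding D_def s_def c_def by (rule ellipse_pos)
  have DN: "D\<^sup>2 + N\<^sup>2 = Q"
    unfolding D_def N_def Q_def s_def c_def by (rule ellipse_norm)
  have Q: "Q > 0" using D DN by (metis add_pos_nonneg zero_less_power zero_le_power2)
  have "((\<lambda>x. (b - a) * sin x * cos x) has_real_derivative N') (at x within S)"
    unfolding N'_def s_def c_def
    by (auto intro!: derivative_eq_intros simp: power2_eq_square algebra_simps)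
  moreover have "((\<lambda>x. a * (cos x)\<^sup>2 + b * (sin x)\<^sup>2) has_real_derivative D') (at x within S)"
    unfolding D'_def s_def c_def
    by (auto intro!: derivative_eq_intros simp: algebra_simps)
  ultimately have "((\<lambda>x. (b - a) * sin x * cos x / (a * (cos x)\<^sup>2 + b * (sin x)\<^sup>2))
      has_real_derivative (N' * D - N * D') / (D * D)) (at x within S)"
    using D DERIV_divide[where f = "\<lambda>x. (b - a) * sin x * cos x"
        and g = "\<lambda>x. a * (cos x)\<^sup>2 + b * (sin x)\<^sup>2" and x = x and s = S]
    by (simp add: D_def N_def s_def c_def)
  from DERIV_add[OF DERIV_ident DERIV_chain2[OF DERIV_arctan this]]
  have "(ellipse_angle a b has_real_derivative
      1 + inverse (1 + (N / D)\<^sup>2) * ((N' * D - N * D') / (D * D))) (at x within S)"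
    unfolding ellipse_angle_def[abs_def] by (simp add: D_def N_def s_def c_def)
  \<comment> \<open>By \<open>DN\<close>, the denominator produced by \<open>arctan\<close> cancels
    the \<open>D * D\<close> of the quotient rule and leaves \<open>Q\<close>.\<close>
  also have "1 + inverse (1 + (N / D)\<^sup>2) * ((N' * D - N * D') / (D * D)) =
      (Q + (N' * D - N * D')) / Q"
  proof -
    have "1 + (N / D)\<^sup>2 = Q / D\<^sup>2"
      using D DN by (simp add: field_simps)
    then show ?thesis
      using D Q by (simp add: field_simps power2_eq_square)
  qed
  also have "Q + (N' * D - N * D') = a * b"
  proof -
    have "s\<^sup>2 + c\<^sup>2 = 1" by (simp add: s_def c_def)
    then show ?thesis unfolding Q_def N'_def N_def D_def D'_def by algebra
  qed
  finally show ?thesis by (simp add: Q_def s_def c_def)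
qed

text \<open>With the endpoints fixed, monotonicity makes the substitution map
  \<open>{-pi..pi}\<close> into itself.\<close>

lemma ellipse_angle_mono:
  assumes "x \<le> y"
  shows "ellipse_angle a b x \<le> ellipse_angle a b y"
proof (rule DERIV_nonneg_imp_nondecreasing[OF assms])
  fix x
  have "a * b / (a\<^sup>2 * (cos x)\<^sup>2 + b\<^sup>2 * (sin x)\<^sup>2) \<ge> 0"
    using a b by simp
  then show "\<exists>d. (ellipse_angle a b has_real_derivative d) (at x) \<and> 0 \<le> d"
    using ellipse_angle_deriv by blast
qed

end

section \<open>Substitution into the elliptic integrand and evaluation\<close>

theorem theorem1:
  fixes \<beta> lam :: real and s :: complex
  assumes "\<beta> \<ge> lam" and "lam > 0"
  shows "((\<lambda>\<theta>::real. complex_of_real ((cos \<theta>)\<^sup>2 / \<beta>\<^sup>2 + (sin \<theta>)\<^sup>2 / lam\<^sup>2) powr s) has_integral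
           (2 * complex_of_real pi * complex_of_real lam / complex_of_real \<beta> powr (1 + 2 * s)
             * hypergeo_2F1 (1 / 2) (1 + s) 1 (complex_of_real (1 - lam\<^sup>2 / \<beta>\<^sup>2)))) {-pi..pi}"
proof -
  have lam: "lam > 0" and beta: "\<beta> > 0"
    using assms by auto
  define k where "k = 1 - lam\<^sup>2 / \<beta>\<^sup>2"
  have k: "0 \<le> k" "k < 1"
    using assms lam beta by (auto simp: k_def)
  let ?Q = "\<lambda>x. \<beta>\<^sup>2 * (cos x)\<^sup>2 + lam\<^sup>2 * (sin x)\<^sup>2"
  let ?f = "\<lambda>\<theta>. complex_of_real ((cos \<theta>)\<^sup>2 / \<beta>\<^sup>2 + (sin \<theta>)\<^sup>2 / lam\<^sup>2) powr s"
  let ?g = "ellipse_angle \<beta> lam"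
  have Q: "?Q x = \<beta>\<^sup>2 * (1 - k * (sin x)\<^sup>2)" for x
    using beta by (simp add: k_def cos_squared_eq field_simps)
  have Q_pos: "?Q x > 0" for x
    using ellipse_pos[of "\<beta>\<^sup>2" "lam\<^sup>2" x] lam beta by simp
  \<comment> \<open>The \<open>arctan\<close> term vanishes because \<open>sin\<close> does, so the
    interval of integration is preserved.\<close>
  have ends: "?g (- pi) = - pi" "?g pi = pi"
    by (simp_all add: ellipse_angle_def)
  have cont: "continuous_on {-pi..pi} ?f"
  proof (intro continuous_on_powr_complex continuous_intros)
    \<comment> \<open>This condition concerns only zeros of the base; the base is positive, so the
      case is contradictory and \<open>s\<close> stays arbitrary.\<close>
    show "0 < Re s" if "complex_of_real ((cos x)\<^sup>2 / \<beta>\<^sup>2 + (sin x)\<^sup>2 / lam\<^sup>2) = 0" for x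
    proof -
      have "(1 / \<beta>\<^sup>2) * (cos x)\<^sup>2 + (1 / lam\<^sup>2) * (sin x)\<^sup>2 > 0"
        using lam beta by (intro ellipse_pos) auto
      with that show ?thesis
        by (simp only: of_real_eq_0_iff) simp
    qed
  qed (use lam beta in auto)
  have "((\<lambda>x. (\<beta> * lam / ?Q x) *\<^sub>R ?f (?g x)) has_integral integral {?g (- pi)..?g pi} ?f) {-pi..pi}"
  proof (rule has_integral_substitution[OF _ _ _ cont])
    show "?g ` {- pi..pi} \<subseteq> {- pi..pi}"
      using ellipse_angle_mono[OF beta lam] ends by (metis atLeastAtMost_iff image_subsetI)
  qed (use ends ellipse_angle_deriv[OF beta lam] in auto)
  moreover have "(\<beta> * lam / ?Q x) *\<^sub>R ?f (?g x) =
      complex_of_real lam / complex_of_real \<beta> powr (1 + 2 * s) *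
        (1 - complex_of_real k * complex_of_real ((sin x)\<^sup>2)) powr (- (1 + s))" for x
  proof -
    define w where "w = 1 - k * (sin x)\<^sup>2"
    have w: "w > 0" and Qw: "?Q x = \<beta>\<^sup>2 * w"
      using Q_pos[of x] Q[of x] beta by (auto simp: w_def zero_less_mult_iff)
    \<comment> \<open>The factors \<open>\<beta>\<close> and \<open>lam\<close> from
      \<open>cos_sin_ellipse_angle\<close> cancel the denominators. The sum of squares on the right
      is kept unsimplified so that both sides split alike.\<close>
    have "(cos (?g x))\<^sup>2 / \<beta>\<^sup>2 + (sin (?g x))\<^sup>2 / lam\<^sup>2 = ((cos x)\<^sup>2 + (sin x)\<^sup>2) / ?Q x"
      using lam beta Q_pos[of x]
      by (simp add: cos_sin_ellipse_angle power_divide power_mult_distrib add_divide_distrib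
          del: sin_cos_squared_add sin_cos_squared_add2)
    also have "\<dots> = 1 / (\<beta>\<^sup>2 * w)"
      by (simp add: Qw)
    finally have "?f (?g x) = complex_of_real (1 / (\<beta>\<^sup>2 * w)) powr s"
      by simp
    \<comment> \<open>All bases are positive reals, so powers become exponentials of real logarithms
      and exponents can be added without branch issues. The Jacobian adds
      \<open>- ln \<beta> - ln w\<close>, which turns the exponents -2s and -s into -(1+2s) and
      -(1+s).\<close>
    also have "\<dots> = exp (s * complex_of_real (ln (1 / (\<beta>\<^sup>2 * w))))"
      unfolding powr_def using beta w by (subst Ln_of_real) auto
    also have "ln (1 / (\<beta>\<^sup>2 * w)) = - (2 * ln \<beta> + ln w)"
      using beta w by (simp add: ln_div ln_mult ln_realpow)
    finally have "?f (?g x) = exp (- s * (2 * complex_of_real (ln \<beta>) + complex_of_real (ln w)))"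
      by (simp add: algebra_simps)
    moreover have "complex_of_real (\<beta> * lam / ?Q x) =
        complex_of_real lam * exp (- complex_of_real (ln \<beta>) - complex_of_real (ln w))"
    proof -
      have "\<beta> * lam / ?Q x = lam * exp (- ln \<beta> - ln w)"
        unfolding Qw using beta w by (simp add: exp_diff exp_minus power2_eq_square field_simps)
      then show ?thesis
        by (simp flip: exp_of_real)
    qed
    ultimately have "(\<beta> * lam / ?Q x) *\<^sub>R ?f (?g x) = complex_of_real lam *
        exp (- (1 + 2 * s) * complex_of_real (ln \<beta>) + - (1 + s) * complex_of_real (ln w))"
      by (simp only: scaleR_conv_of_real mult.assoc flip: exp_add) (simp add: algebra_simps)
    also have "\<dots> = complex_of_real lam / complex_of_real \<beta> powr (1 + 2 * s) *
        complex_of_real w powr (- (1 + s))"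
    proof -
      have "complex_of_real \<beta> powr (1 + 2 * s) = exp ((1 + 2 * s) * complex_of_real (ln \<beta>))"
        "complex_of_real w powr (- (1 + s)) = exp (- (1 + s) * complex_of_real (ln w))"
        using beta w by (simp_all add: powr_def Ln_of_real)
      then show ?thesis
        by (simp only: exp_add divide_inverse mult_minus_left exp_minus mult.assoc)
    qed
    finally show ?thesis by (simp add: w_def)
  qed
  moreover have "((\<lambda>x. complex_of_real lam / complex_of_real \<beta> powr (1 + 2 * s) *
        (1 - complex_of_real k * complex_of_real ((sin x)\<^sup>2)) powr (- (1 + s))) has_integral
      complex_of_real lam / complex_of_real \<beta> powr (1 + 2 * s) *
        (2 * complex_of_real pi * hypergeo_2F1 (1 / 2) (1 + s) 1 (complex_of_real k))) {-pi..pi}"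
    using k by (intro has_integral_mult_right has_integral_hypergeo_2F1_half) auto
  ultimately have "integral {-pi..pi} ?f = complex_of_real lam / complex_of_real \<beta> powr (1 + 2 * s) *
      (2 * complex_of_real pi * hypergeo_2F1 (1 / 2) (1 + s) 1 (complex_of_real k))"
    using ends by (simp only: has_integral_unique)
  moreover have "(?f has_integral integral {-pi..pi} ?f) {-pi..pi}"
    using cont by (intro integrable_integral integrable_continuous_interval)
  ultimately show ?thesis
    by (simp add: k_def mult_ac)
qed

end
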